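(* For each integer $d\geq 1$, let $\mathcal{C}_d$ denote the set of all closed balls in $\ell_\infty^d$. Then the Vapnik-Chervonenkis dimension of $\mathcal{C}_d$ satisfies $\mathrm{VC\text{-}dim}(\mathcal{C}_d)=\lfloor (3d+1)/2\rfloor$.
   Context: $\ell_\infty^d$ denotes the vector space $\mathbb{R}^d$ equipped with the norm $\|\mathbf{x}\|_\infty=\max\{|x_1|,\dots,|x_d|\}$. The closed balls (of positive finite radius) in $\ell_\infty^d$ are exactly the closed cubes with sides parallel to the coordinate axes, i.e. the sets $\prod_{i=1}^d[c_i-r,c_i+r]$ with $c\in\mathbb{R}^d$, $r>0$. A family $\mathcal{E}$ of subsets of a set $X$ shatters a finite set $\sigma\subset X$ if for every $\sigma'\subset\sigma$ there is $C\in\mathcal{E}$ with $C\cap\sigma=\sigma'$ (equivalently $\#\{C\cap\sigma: C\in\mathcal{E}\}=2^{\#\sigma}$). The Vapnik-Chervonenkis dimension is $\mathrm{VC\text{-}dim}(\mathcal{E})=\sup\{\#\sigma : \sigma\subset X \text{ is finite and } \mathcal{E} \text{ shatters } \sigma\}$. *)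

theory Defs
  imports "HOL-Analysis.Analysis" "HOL-Library.Extended_Nat"
begin

definition shatters :: "'a set set \<Rightarrow> 'a set \<Rightarrow> bool" where
  "shatters E S \<longleftrightarrow> (\<forall>T. T \<subseteq> S \<longrightarrow> (\<exists>C\<in>E. C \<inter> S = T))"

text \<open>
  The supremum is taken in \<^typ>\<open>enat\<close>, so it is \<^term>\<open>\<infinity> :: enat\<close> when arbitrarily large
  finite sets are shattered.
\<close>

definition vc_dim :: "'a set \<Rightarrow> 'a set set \<Rightarrow> enat" where
  "vc_dim X E = (SUP S\<in>{S. S \<subseteq> X \<and> finite S \<and> shatters E S}. enat (card S))"

text \<open>
  The norm of \<open>\<ell>\<^sub>\<infinity>\<^sup>d\<close> is the library's \<^const>\<open>infnorm\<close>. It is not the \<^const>\<open>norm\<close> of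
  the type \<^typ>\<open>real ^ 'd\<close>, which is Euclidean, so \<^const>\<open>cball\<close> does not apply.
\<close>

lemma infnorm_eq_Max: "infnorm (x :: real ^ 'd) = Max (range (\<lambda>i. \<bar>x $ i\<bar>))"
proof -
  have "{\<bar>x $ i\<bar> | i. i \<in> UNIV} = range (\<lambda>i. \<bar>x $ i\<bar>)"
    by auto
  then show ?thesis
    by (simp add: infnorm_cart cSup_eq_Max)
qed

definition linf_cball :: "real ^ 'd \<Rightarrow> real \<Rightarrow> (real ^ 'd) set" where
  "linf_cball c r = {x. infnorm (x - c) \<le> r}"

definition linf_cballs :: "(real ^ 'd) set set" where
  "linf_cballs = {linf_cball c r | c r. r > 0}"

lemma linf_cball_eq: "linf_cball c r = {x. \<forall>i. c $ i - r \<le> x $ i \<and> x $ i \<le> c $ i + r}"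
  by (auto simp: linf_cball_def infnorm_eq_Max abs_le_iff algebra_simps)

end

theory Submission
  imports Defs
begin

text \<open>
  Upper bound. Let \<open>S\<close> be shattered and choose in each coordinate \<open>k\<close> a point of \<open>S\<close> where
  that coordinate is maximal and one where it is minimal; call them the extreme points of \<open>k\<close>.
  A cube that contains the extreme points of \<open>k\<close> cannot exclude any point of \<open>S\<close> through the
  coordinate \<open>k\<close>. As each single point can be excluded, each point is extreme for some coordinate.
  Let \<open>i\<close> be a coordinate of maximal width. If \<open>j \<noteq> i\<close>, at most one point is extreme for \<open>j\<close>
  only: otherwise a cube excluding just the two extreme points of \<open>j\<close> would have a side shorter
  than the width of \<open>j\<close>, and yet contain the extreme points of \<open>i\<close>. So at most \<open>d + 1\<close> points are
  extreme for only one coordinate, and counting the at most \<open>2d\<close> incidences gives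
  \<open>2 |S| \<le> 3d + 1\<close>.

  Lower bound. One coordinate serves to separate two points far apart; every further pair of
  coordinates accommodates three points with these coordinates \<open>(2, 0)\<close>, \<open>(1, 1)\<close>,
  \<open>(-1, -1)\<close>, any subset of which can be excluded by one half-line in each of the two coordinates
  without excluding the origin.
\<close>

section \<open>The upper bound\<close>

text \<open>Double counting: an element lying in a single \<open>E k\<close> is counted once more
  through the exclusive set \<open>X k\<close>, so every element contributes at least 2. The
  \<open>E k\<close> give at most 2d, the \<open>X k\<close> at most d + 1, since only
  \<open>X i\<close> may have two elements.\<close>

lemma card_le_by_exclusive_elements:
  fixes E :: "'d::finite \<Rightarrow> 'a set"
  assumes S: "S = (\<Union>k. E k)"
    and two: "\<And>k. finite (E k) \<and> card (E k) \<le> 2"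
    and one: "\<And>j. j \<noteq> i \<Longrightarrow> card (S - (\<Union>k\<in>-{j}. E k)) \<le> 1"
  shows "2 * card S \<le> 3 * CARD('d) + 1"
proof -
  define X where "X j = S - (\<Union>k\<in>-{j}. E k)" for j
  have fin: "finite S"
    using S two by simp
  have X_sub: "X j \<subseteq> E j" for j
    using S by (auto simp: X_def)
  have two_le: "2 \<le> card {k. x \<in> E k} + card {k. x \<in> X k}" if x: "x \<in> S" for x
  proof -
    obtain k where k: "x \<in> E k"
      using x S by auto
    show ?thesis
    proof (cases "\<exists>l. l \<noteq> k \<and> x \<in> E l")
      case True
      then obtain l where "l \<noteq> k" "x \<in> E l"
        by auto
      with k have "{k, l} \<subseteq> {k. x \<in> E k}" "card {k, l} = 2"
        by auto
      then show ?thesis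
        by (metis card_mono finite_code trans_le_add1)
    next
      case False
      then have "x \<in> X k"
        using x by (auto simp: X_def)
      then have "card {k. x \<in> E k} > 0" "card {k. x \<in> X k} > 0"
        using k by (auto simp: card_gt_0_iff)
      then show ?thesis
        by linarith
    qed
  qed
  have count: "(\<Sum>x\<in>S. card {k. x \<in> F k}) = (\<Sum>k\<in>UNIV. card (F k))"
    if "\<And>k. F k \<subseteq> S" for F :: "'d \<Rightarrow> 'a set"
  proof -
    have "(\<Sum>x\<in>S. card {k. x \<in> F k}) = (\<Sum>x\<in>S. \<Sum>k\<in>UNIV. if x \<in> F k then 1 else 0)"
      by (simp add: sum.If_cases)
    also have "\<dots> = (\<Sum>k\<in>UNIV. \<Sum>x\<in>S. if x \<in> F k then 1 else 0)"
      by (rule sum.swap)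
    also have "\<dots> = (\<Sum>k\<in>UNIV. card (F k))"
      using that fin by (simp add: sum.If_cases Int_absorb1)
    finally show ?thesis .
  qed
  have "2 * card S = (\<Sum>x\<in>S. 2)"
    by simp
  also have "\<dots> \<le> (\<Sum>x\<in>S. card {k. x \<in> E k} + card {k. x \<in> X k})"
    by (rule sum_mono) (rule two_le)
  also have "\<dots> = (\<Sum>k\<in>UNIV. card (E k)) + (\<Sum>k\<in>UNIV. card (X k))"
    using count[of E] count[of X] S by (auto simp: sum.distrib X_def)
  also have "\<dots> \<le> (\<Sum>k\<in>(UNIV::'d set). 2) + (\<Sum>k\<in>UNIV. 1 + (if k = i then 1 else 0))"
  proof (intro add_mono sum_mono)
    show "card (E k) \<le> 2" for k
      using two by simp
    show "card (X k) \<le> 1 + (if k = i then 1 else 0)" for k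
      using one[of k] X_sub[of k] two[of k] card_mono[of "E k" "X k"] by (auto simp: X_def)
  qed
  also have "\<dots> = 3 * CARD('d) + 1"
    by (subst sum.distrib) simp
  finally show ?thesis .
qed

lemma card_shattered_le:
  fixes S :: "(real ^ 'd) set"
  assumes "finite S" and sh: "shatters linf_cballs S"
  shows "2 * card S \<le> 3 * CARD('d) + 1"
proof (cases "S = {}")
  case False
  have "\<exists>p\<in>S. \<forall>x\<in>S. p $ k \<le> x $ k" "\<exists>q\<in>S. \<forall>x\<in>S. x $ k \<le> q $ k" for k
    using ex_is_arg_min_if_finite[OF \<open>finite S\<close> False, of "\<lambda>x. x $ k"]
      ex_is_arg_min_if_finite[OF \<open>finite S\<close> False, of "\<lambda>x. - x $ k"]
    by (auto simp: is_arg_min_def not_less)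
  then obtain p q where p: "\<And>k. p k \<in> S" "\<And>k x. x \<in> S \<Longrightarrow> p k $ k \<le> x $ k"
    and q: "\<And>k. q k \<in> S" "\<And>k x. x \<in> S \<Longrightarrow> x $ k \<le> q k $ k"
    by metis
  define E where "E k = {p k, q k}" for k
  define w where "w k = q k $ k - p k $ k" for k
  have "\<exists>i. \<forall>k. w k \<le> w i"
    using Max_in[of "range w"] Max_ge[of "range w"] by fastforce
  then obtain i where i: "\<And>k. w k \<le> w i"
    by auto
  have cube: "\<exists>c r. \<forall>x\<in>S. x \<in> T \<longleftrightarrow> (\<forall>k. c $ k - r \<le> x $ k \<and> x $ k \<le> c $ k + r)" if "T \<subseteq> S" for T
  proof -
    obtain C where "C \<in> linf_cballs" "C \<inter> S = T"
      using sh \<open>T \<subseteq> S\<close> by (auto simp: shatters_def)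
    then obtain c r where "linf_cball c r \<inter> S = T"
      by (auto simp: linf_cballs_def)
    then show ?thesis
      by (intro exI[of _ c] exI[of _ r]) (auto simp: linf_cball_eq)
  qed
  show ?thesis
  proof (rule card_le_by_exclusive_elements)
    show "S = (\<Union>k. E k)"
    proof
      show "S \<subseteq> (\<Union>k. E k)"
      proof
        fix x assume x: "x \<in> S"
        obtain c r where cr: "\<forall>y\<in>S. y \<in> S - {x} \<longleftrightarrow> (\<forall>k. c $ k - r \<le> y $ k \<and> y $ k \<le> c $ k + r)"
          using cube[of "S - {x}"] by auto
        then obtain k where "x $ k < c $ k - r \<or> c $ k + r < x $ k"
          using x by (meson DiffD2 insertI1 not_le)
        \<comment> \<open>The extreme point on the side where \<open>x\<close> leaves the cube lies
          at least as far out, so it is excluded too; but only \<open>x\<close> is.\<close>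
        then have "p k \<notin> S - {x} \<or> q k \<notin> S - {x}"
          using cr p q x by (meson order_trans not_le)
        then have "x = p k \<or> x = q k"
          using p(1) q(1) by blast
        then show "x \<in> (\<Union>k. E k)"
          by (auto simp: E_def)
      qed
    qed (use p q in \<open>auto simp: E_def\<close>)
    show "finite (E k) \<and> card (E k) \<le> 2" for k
      by (simp add: E_def card_insert_if)
    show "card (S - (\<Union>k\<in>-{j}. E k)) \<le> 1" if "j \<noteq> i" for j
    proof (rule ccontr)
      define T where "T = (\<Union>k\<in>-{j}. E k)"
      assume "\<not> card (S - (\<Union>k\<in>-{j}. E k)) \<le> 1"
      then have big: "\<not> S - T \<subseteq> {x}" for x
        using card_mono[of "{x}" "S - T"] by (auto simp: T_def[symmetric])
      have "S - T \<subseteq> {p j, q j}"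
        using \<open>S = (\<Union>k. E k)\<close> by (auto simp: T_def E_def)
      then have out: "p j \<notin> T" "q j \<notin> T"
        using big[of "p j"] big[of "q j"] by blast+
      have "T \<subseteq> S"
        using p q by (auto simp: T_def E_def)
      then obtain c r
        where cr: "\<forall>y\<in>S. y \<in> T \<longleftrightarrow> (\<forall>k. c $ k - r \<le> y $ k \<and> y $ k \<le> c $ k + r)"
        using cube by blast
      have in_T: "p k \<in> T" "q k \<in> T" if "k \<noteq> j" for k
        using that by (auto simp: T_def E_def)
      have inside: "c $ k - r \<le> x $ k \<and> x $ k \<le> c $ k + r" if "k \<noteq> j" "x \<in> S" for k x
        using cr in_T[OF \<open>k \<noteq> j\<close>] p q \<open>x \<in> S\<close> by (meson order_trans)
      \<comment> \<open>The side is at least \<open>w i\<close>. In coordinate \<open>j\<close> the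
        interval contains the value of \<open>p i\<close> but misses those of \<open>p j\<close> and
        \<open>q j\<close>, which surround it; hence 2r < \<open>w j\<close>.\<close>
      have "w i \<le> 2 * r"
        using inside[of i "p i"] inside[of i "q i"] p q \<open>j \<noteq> i\<close> by (auto simp: w_def)
      moreover have "c $ j - r \<le> p i $ j \<and> p i $ j \<le> c $ j + r"
        using cr in_T \<open>j \<noteq> i\<close> p by metis
      moreover have "\<not> (c $ j - r \<le> x $ j \<and> x $ j \<le> c $ j + r)" if "x \<in> {p j, q j}" for x
        using that cr inside out p q by (metis empty_iff insert_iff)
      then have "\<not> (c $ j - r \<le> p j $ j \<and> p j $ j \<le> c $ j + r)"
        "\<not> (c $ j - r \<le> q j $ j \<and> q j $ j \<le> c $ j + r)"
        by simp_all
      moreover have "p j $ j \<le> p i $ j" "p i $ j \<le> q j $ j"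
        using p q by simp_all
      ultimately show False
        using i[of j] unfolding w_def[of j] by linarith
    qed
  qed
qed simp

lemma vc_dim_linf_cballs_le:
  "vc_dim UNIV (linf_cballs :: (real ^ 'd) set set) \<le> enat ((3 * CARD('d) + 1) div 2)"
  unfolding vc_dim_def
proof (rule SUP_least)
  fix S :: "(real ^ 'd) set"
  assume "S \<in> {S. S \<subseteq> UNIV \<and> finite S \<and> shatters linf_cballs S}"
  then have "2 * card S \<le> 3 * CARD('d) + 1"
    using card_shattered_le by auto
  then show "enat (card S) \<le> enat ((3 * CARD('d) + 1) div 2)"
    by simp
qed

section \<open>The lower bound\<close>

text \<open>Distinctness of the points comes for free: a set cutting out the index \<open>m\<close>
  alone separates \<open>f m\<close> from the others.\<close>

lemma card_le_vc_dim_of_indexed: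
  assumes "finite I"
    and sh: "\<And>T. T \<subseteq> I \<Longrightarrow> \<exists>C\<in>E. \<forall>n\<in>I. f n \<in> C \<longleftrightarrow> n \<in> T"
  shows "enat (card I) \<le> vc_dim UNIV E"
proof -
  have inj: "inj_on f I"
  proof
    fix m n assume "m \<in> I" "n \<in> I" "f m = f n"
    moreover from \<open>m \<in> I\<close> obtain C where "\<forall>n\<in>I. f n \<in> C \<longleftrightarrow> n \<in> {m}"
      using sh[of "{m}"] by blast
    ultimately show "m = n"
      by (metis singleton_iff)
  qed
  have "shatters E (f ` I)"
    unfolding shatters_def
  proof (intro allI impI)
    fix U assume U: "U \<subseteq> f ` I"
    obtain C where "C \<in> E" "\<forall>n\<in>I. f n \<in> C \<longleftrightarrow> n \<in> {n\<in>I. f n \<in> U}"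
      using sh[of "{n\<in>I. f n \<in> U}"] by auto
    then show "\<exists>C\<in>E. C \<inter> f ` I = U"
      using U by (intro bexI[of _ C]) auto
  qed
  then show ?thesis
    using \<open>finite I\<close> inj unfolding vc_dim_def
    by (intro SUP_upper2[of "f ` I"]) (auto simp: card_image)
qed

text \<open>
  Points \<open>0\<close> and \<open>1\<close> are separated by coordinate \<open>0\<close>; points \<open>3m + 2\<close>, \<open>3m + 3\<close>, \<open>3m + 4\<close> live in
  the coordinates \<open>2m + 1\<close> and \<open>2m + 2\<close>.
\<close>

definition shattered_point :: "nat \<Rightarrow> nat \<Rightarrow> real" where
  "shattered_point n k =
    (if k = 0 then (if n = 0 then 10 else if n = 1 then - 10 else 0)
     else if odd k then
       (let m = k div 2 in
        if n = 3 * m + 2 then 2 else if n = 3 * m + 3 then 1 else if n = 3 * m + 4 then - 1 else 0)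
     else
       (let m = k div 2 - 1 in
        if n = 3 * m + 3 then 1 else if n = 3 * m + 4 then - 1 else 0))"

text \<open>Radius 10 is for covering both 10 and -10; radius 9 with centre 1, -1 or 0 keeps one of
  them or neither. Elsewhere values are at most 2 in size, so a face at 0 or 1 acts as a
  half-line.\<close>

definition cutting_radius :: "nat set \<Rightarrow> real" where
  "cutting_radius T = (if 0 \<in> T \<and> 1 \<in> T then 10 else 9)"

text \<open>If (2, 0) is to go, the first coordinate removes it, with (1, 1) if needed, and the
  second handles (-1, -1). Otherwise the first handles (-1, -1) and the second (1, 1).\<close>

definition cutting_center :: "nat set \<Rightarrow> nat \<Rightarrow> real" where
  "cutting_center T k =
    (let r = cutting_radius T in
     if k = 0 then
       (if 0 \<in> T \<and> 1 \<notin> T then 1 else if 0 \<notin> T \<and> 1 \<in> T then - 1 else 0)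
     else if odd k then
       (let m = k div 2 in
        if 3 * m + 2 \<notin> T then (if 3 * m + 3 \<in> T then 1 - r else - r)
        else if 3 * m + 4 \<in> T then 0 else r)
     else
       (let m = k div 2 - 1 in
        if 3 * m + 2 \<notin> T then (if 3 * m + 4 \<in> T then 0 else r)
        else if 3 * m + 3 \<in> T then 0 else - r))"

lemma coordinate_cases:
  obtains "k = 0" | m where "k = 2 * m + 1" | m where "k = 2 * m + (2::nat)"
proof (cases "k = 0")
  case False
  then have "k = 2 * (k div 2) + 1 \<or> k = 2 * (k div 2 - 1) + 2"
    by presburger
  then show thesis
    using that(2,3) by blast
qed (use that in simp)

lemma point_cases:
  obtains "n = 0" | "n = 1" | m where "n = 3 * m + 2" | m where "n = 3 * m + 3"
    | m where "n = 3 * m + (4::nat)"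
proof (cases "n < 2")
  case False
  then have "n = 3 * ((n - 2) div 3) + 2 \<or> n = 3 * ((n - 2) div 3) + 3 \<or> n = 3 * ((n - 2) div 3) + 4"
    by presburger
  then show thesis
    using that by blast
qed (use that in \<open>auto simp: less_2_cases_iff\<close>)

lemma mod_clashes:
  "3 * m + 2 \<noteq> 3 * l + (3::nat)" "3 * m + 2 \<noteq> 3 * l + (4::nat)" "3 * m + 3 \<noteq> 3 * l + (4::nat)"
  by presburger+

lemma cutting_cube_iff:
  assumes n: "n < (3 * d + 1) div 2" and "d \<ge> 1"
  shows "(\<forall>k<d. \<bar>shattered_point n k - cutting_center T k\<bar> \<le> cutting_radius T) \<longleftrightarrow> n \<in> T"
proof -
  note defs = shattered_point_def cutting_center_def Let_def
  let ?ok = "\<lambda>k. \<bar>shattered_point n k - cutting_center T k\<bar> \<le> cutting_radius T"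
  have radius: "9 \<le> cutting_radius T"
    by (simp add: cutting_radius_def)
  \<comment> \<open>Every side contains 0, so no point is excluded through a coordinate where it
    vanishes.\<close>
  have center: "\<bar>cutting_center T k\<bar> \<le> cutting_radius T" for k
  proof -
    have "cutting_center T k \<in>
        {1, - 1, 0, 1 - cutting_radius T, - cutting_radius T, cutting_radius T}"
      by (simp add: cutting_center_def Let_def)
    with radius show ?thesis
      by auto
  qed
  show ?thesis
  proof (cases n rule: point_cases)
    case 1
    have "?ok k" if "k \<noteq> 0" for k
      using that center[of k] 1 by (simp add: shattered_point_def)
    moreover have "?ok 0 \<longleftrightarrow> n \<in> T"
      using 1 by (cases "0 \<in> T"; cases "1 \<in> T") (simp_all add: defs cutting_radius_def)
    ultimately show ?thesis
      using \<open>d \<ge> 1\<close> by (metis less_eq_Suc_le One_nat_def)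
  next
    case 2
    have "?ok k" if "k \<noteq> 0" for k
      using that center[of k] 2 by (simp add: shattered_point_def)
    moreover have "?ok 0 \<longleftrightarrow> n \<in> T"
      using 2 by (cases "0 \<in> T"; cases "1 \<in> T") (simp_all add: defs cutting_radius_def)
    ultimately show ?thesis
      using \<open>d \<ge> 1\<close> by (metis less_eq_Suc_le One_nat_def)
  next
    case (3 m)
    have "?ok k" if "k \<noteq> 2 * m + 1" for k
      using that center[of k] 3
      by (cases k rule: coordinate_cases) (simp_all add: shattered_point_def mod_clashes)
    moreover have "?ok (2 * m + 1) \<longleftrightarrow> n \<in> T"
      using 3 radius
      by (cases "3 * m + 2 \<in> T"; cases "3 * m + 3 \<in> T"; cases "3 * m + 4 \<in> T")
        (simp_all add: defs mod_clashes mod_clashes[symmetric])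
    \<comment> \<open>For even \<open>d\<close> the last pair lacks its second coordinate; the bound
      on \<open>n\<close> then leaves only this point of the triple, which needs just the
      first.\<close>
    moreover have "2 * m + 1 < d"
      using n 3 by linarith
    ultimately show ?thesis
      by metis
  next
    case (4 m)
    have "?ok k" if "k \<noteq> 2 * m + 1" "k \<noteq> 2 * m + 2" for k
      using that center[of k] 4
      by (cases k rule: coordinate_cases)
        (simp_all add: shattered_point_def mod_clashes mod_clashes[symmetric])
    moreover have "?ok (2 * m + 1) \<and> ?ok (2 * m + 2) \<longleftrightarrow> n \<in> T"
      using 4 radius
      by (cases "3 * m + 2 \<in> T"; cases "3 * m + 3 \<in> T"; cases "3 * m + 4 \<in> T")
        (simp_all add: defs mod_clashes mod_clashes[symmetric])
    moreover have "2 * m + 1 < d" "2 * m + 2 < d"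
      using n 4 by linarith+
    ultimately show ?thesis
      by metis
  next
    case (5 m)
    have "?ok k" if "k \<noteq> 2 * m + 1" "k \<noteq> 2 * m + 2" for k
      using that center[of k] 5
      by (cases k rule: coordinate_cases)
        (simp_all add: shattered_point_def mod_clashes mod_clashes[symmetric])
    moreover have "?ok (2 * m + 1) \<and> ?ok (2 * m + 2) \<longleftrightarrow> n \<in> T"
      using 5 radius
      by (cases "3 * m + 2 \<in> T"; cases "3 * m + 3 \<in> T"; cases "3 * m + 4 \<in> T")
        (simp_all add: defs mod_clashes mod_clashes[symmetric])
    moreover have "2 * m + 1 < d" "2 * m + 2 < d"
      using n 5 by linarith+
    ultimately show ?thesis
      by metis
  qed
qed

lemma vc_dim_linf_cballs_ge:
  "enat ((3 * CARD('d) + 1) div 2) \<le> vc_dim UNIV (linf_cballs :: (real ^ 'd) set set)"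
proof -
  let ?N = "(3 * CARD('d) + 1) div 2"
  obtain g :: "'d \<Rightarrow> nat" where g: "bij_betw g UNIV {0..<CARD('d)}"
    using ex_bij_betw_finite_nat[OF finite] by blast
  define f :: "nat \<Rightarrow> real ^ 'd" where "f n = (\<chi> i. shattered_point n (g i))" for n
  have "enat (card {..<?N}) \<le> vc_dim UNIV (linf_cballs :: (real ^ 'd) set set)"
  proof (rule card_le_vc_dim_of_indexed)
    fix T :: "nat set"
    let ?C = "linf_cball (\<chi> i. cutting_center T (g i)) (cutting_radius T) :: (real ^ 'd) set"
    have "f n \<in> ?C \<longleftrightarrow> n \<in> T" if "n < ?N" for n
    proof -
      have "f n \<in> ?C \<longleftrightarrow>
          (\<forall>k\<in>range g. \<bar>shattered_point n k - cutting_center T k\<bar> \<le> cutting_radius T)"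
        by (auto simp: linf_cball_eq f_def abs_le_iff algebra_simps)
      also have "range g = {..<CARD('d)}"
        using g by (auto simp: bij_betw_def)
      finally show ?thesis
        using cutting_cube_iff[OF that] by (simp add: Suc_le_eq lessThan_def)
    qed
    moreover have "cutting_radius T > 0"
      by (simp add: cutting_radius_def)
    then have "?C \<in> linf_cballs"
      unfolding linf_cballs_def by blast
    ultimately show "\<exists>C\<in>linf_cballs. \<forall>n\<in>{..<?N}. f n \<in> C \<longleftrightarrow> n \<in> T"
      by auto
  qed simp
  then show ?thesis
    by simp
qed

theorem mainTheorem1:
  shows "vc_dim UNIV (linf_cballs :: (real ^ 'd) set set) = enat ((3 * CARD('d) + 1) div 2)"
  using vc_dim_linf_cballs_le vc_dim_linf_cballs_ge by (rule antisym)

end
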